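(* For the quantile process $\mathrm{Quantile}(\delta)$ on $n$ bins with $\delta \in [1/3, 2/3]$ and any $m \geq 1$, \[ \Pr[\mathrm{Gap}(m) \leq 300 \log n] \geq 1 - O(n^{-2}). \]
   Context: Balls are allocated sequentially into $n$ bins, starting from all loads $0$. Let $x_i^{(t)}$ be the load of bin $i$ after $t$ balls, and $\mathrm{Gap}(t) := \max_{i} x_i^{(t)} - t/n$. Let $\mathrm{Rank}^{(t)}$ order bins by non-increasing load (rank $1$ = most loaded; ties broken arbitrarily). In $\mathrm{Quantile}(\delta)$, with $\delta$ a fixed multiple of $1/n$ used at every step, two bins are sampled independently and uniformly at random (with replacement); if exactly one of them has rank $> \delta n$, the ball is placed into it, otherwise into one of the two chosen uniformly at random. As throughout the paper, $n$ is assumed sufficiently large. *)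

theory Defs
  imports "HOL-Probability.Probability" "HOL-Library.Landau_Symbols"
begin

text \<open>
  The bins are \<open>{1..n}\<close>. The state after \<open>t\<close> balls is the list \<open>h\<close>, of length \<open>t\<close>, of the bins
  that received the balls, most recent first; the initial state \<open>[]\<close> has all loads 0.
\<close>

definition load :: "nat list \<Rightarrow> nat \<Rightarrow> nat" where
  "load h i = count_list h i"

definition gap :: "nat \<Rightarrow> nat list \<Rightarrow> real" where
  "gap n h = real (Max (load h ` {1..n})) - real (length h) / real n"

definition is_ranking :: "nat \<Rightarrow> nat list \<Rightarrow> (nat \<Rightarrow> nat) \<Rightarrow> bool" where
  "is_ranking n h r \<longleftrightarrow>
     bij_betw r {1..n} {1..n} \<and>
     (\<forall>i\<in>{1..n}. \<forall>j\<in>{1..n}. r i < r j \<longrightarrow> load h i \<ge> load h j)"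

text \<open>
  Ties may be broken arbitrarily: a tie-breaking rule may depend on the whole past of the
  allocation and may itself be randomised, so it maps each past to a distribution over the
  rankings compatible with the current loads. A deterministic rule is one whose values are
  all of the form \<open>return_pmf r\<close>.
\<close>

type_synonym ranking_rule = "nat list \<Rightarrow> (nat \<Rightarrow> nat) pmf"

definition valid_ranking_rule :: "nat \<Rightarrow> ranking_rule \<Rightarrow> bool" where
  "valid_ranking_rule n R \<longleftrightarrow>
     (\<forall>h. set h \<subseteq> {1..n} \<longrightarrow> (\<forall>r\<in>set_pmf (R h). is_ranking n h r))"

text \<open>
  The two samples may coincide; then \<open>pmf_of_set {i, j}\<close> is the point mass at \<open>i\<close>.
\<close>

definition quantile_choice :: "nat \<Rightarrow> real \<Rightarrow> (nat \<Rightarrow> nat) \<Rightarrow> nat pmf" where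
  "quantile_choice n \<delta> r =
     do {
       i \<leftarrow> pmf_of_set {1..n};
       j \<leftarrow> pmf_of_set {1..n};
       if real (r i) > \<delta> * real n \<and> \<not> real (r j) > \<delta> * real n then return_pmf i
       else if real (r j) > \<delta> * real n \<and> \<not> real (r i) > \<delta> * real n then return_pmf j
       else pmf_of_set {i, j}
     }"

primrec quantile_process :: "nat \<Rightarrow> real \<Rightarrow> ranking_rule \<Rightarrow> nat \<Rightarrow> nat list pmf" where
  "quantile_process n \<delta> R 0 = return_pmf []"
| "quantile_process n \<delta> R (Suc t) =
     do {
       h \<leftarrow> quantile_process n \<delta> R t;
       r \<leftarrow> R h;
       b \<leftarrow> quantile_choice n \<delta> r;
       return_pmf (b # h)
     }"

end

theory Submission imports Defs begin

text \<open>
  Let \<open>y\<^sub>i\<close> be the load of bin \<open>i\<close> minus the average, and consider the potential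
  \<open>\<Gamma> = \<Sum>\<^sub>i exp (a y\<^sub>i) + exp (- a y\<^sub>i)\<close> with \<open>a = 1/50\<close>. A bin of rank at most \<open>\<delta>n\<close> (heavy)
  receives the ball with probability \<open>\<delta>/n\<close>, any other bin (light) with probability \<open>(1 + \<delta>)/n\<close>.
  Let \<open>Q\<close> be the value of \<open>a y\<close> separating heavy from light bins; by symmetry \<open>Q \<ge> 0\<close>. If all
  light bins were close to \<open>Q\<close>, the first-order drift of \<open>\<Gamma>\<close> would vanish; but the \<open>y\<^sub>i\<close> sum to zero,
  so the light bins lie below \<open>Q\<close> by a total of at least \<open>nQ\<close>. Such a deficit either makes many
  terms \<open>exp (a y\<^sub>i)\<close> much smaller than \<open>exp Q\<close> or makes some \<open>exp (- a y\<^sub>i)\<close> comparable to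
  \<open>exp Q\<close>, and both yield a drift of order \<open>- a\<Gamma>/n\<close> that dominates the second-order terms, of order
  \<open>a\<^sup>2\<Gamma>/n\<close>. Hence the expectation of \<open>\<Gamma>\<close> stays \<open>O(n)\<close>, and Markov's inequality at the level
  \<open>exp (300 a ln n) = n\<^sup>6\<close> concludes.
\<close>

section \<open>Elementary inequalities\<close>

lemma exp_le_quadratic:
  fixes x :: real
  assumes "\<bar>x\<bar> \<le> 1"
  shows "exp x \<le> 1 + x + x\<^sup>2"
proof (cases "x \<ge> 0")
  case True
  then show ?thesis using assms exp_bound by auto
next
  case False
  define y where "y = - x"
  have y: "y > 0" using False by (simp add: y_def)
  have "1 + y \<le> exp y" by (rule exp_ge_add_one_self)
  then have "exp x \<le> 1 / (1 + y)"
    using y by (simp add: y_def exp_minus field_simps)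
  also have "\<dots> \<le> 1 - y + y\<^sup>2"
  proof -
    have "(1 - y + y\<^sup>2) * (1 + y) = 1 + y ^ 3" by (simp add: algebra_simps power2_eq_square power3_eq_cube)
    then show ?thesis using y by (simp add: divide_le_eq)
  qed
  finally show ?thesis by (simp add: y_def)
qed

text \<open>The left side is the expected factor by which \<open>exp (a * y)\<close> changes for a
  bin of centered load \<open>y\<close> hit with probability \<open>P / n\<close>, since the average
  load always rises by \<open>1 / n\<close>. Both signs of \<open>a\<close> occur later, and
  \<open>5/3\<close> is the largest value of \<open>1 + \<delta>\<close>. Merging the product into a
  single \<open>exp z\<close> lets the quadratic bound apply.\<close>

lemma centered_growth_factor_le:
  fixes a P n :: real
  assumes a: "\<bar>a\<bar> \<le> 1" and P: "0 \<le> P" "P \<le> 5/3" and n: "n \<ge> 60"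
  shows "exp (- a / n) * (1 + P / n * (exp a - 1)) \<le> 1 + a / n * (P - 1) + 2 * a\<^sup>2 / n"
proof -
  define w where "w = exp a - 1"
  define z where "z = (P * w - a) / n"
  have w_le: "w \<le> a + a\<^sup>2" using exp_le_quadratic[OF a] by (simp add: w_def)
  have w_ge: "w \<ge> a" using exp_ge_add_one_self[of a] unfolding w_def by linarith
  have sq: "a\<^sup>2 \<le> \<bar>a\<bar>" using a mult_left_le_one_le[of "\<bar>a\<bar>" "\<bar>a\<bar>"]
    by (simp add: power2_eq_square flip: abs_mult)
  have w_abs: "\<bar>w\<bar> \<le> 2 * \<bar>a\<bar>" using w_le w_ge sq by linarith
  have "\<bar>P * w\<bar> \<le> 5/3 * (2 * \<bar>a\<bar>)"
    unfolding abs_mult using P w_abs by (intro mult_mono) auto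
  then have num: "\<bar>P * w - a\<bar> \<le> 13/3 * \<bar>a\<bar>" by linarith
  have z_abs: "\<bar>z\<bar> \<le> 13/3 * \<bar>a\<bar> / n"
    unfolding z_def abs_divide using divide_right_mono[OF num, of n] n by simp
  have "13/3 * \<bar>a\<bar> / n \<le> 1" using a n by (simp add: divide_le_eq)
  then have z1: "\<bar>z\<bar> \<le> 1" using z_abs by linarith
  have "z\<^sup>2 \<le> (13/3 * \<bar>a\<bar> / n)\<^sup>2"
    using z_abs by (metis abs_ge_zero power2_abs power_mono)
  also have "\<dots> = (169/9 / n) * (a\<^sup>2 / n)" by (simp add: power2_eq_square field_simps)
  \<comment> \<open>This holds from \<open>n = 57\<close> on; the \<open>1/3\<close> completes
    \<open>5/3\<close> in \<open>z3\<close> to the coefficient 2 of the conclusion.\<close>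
  also have "\<dots> \<le> (1/3) * (a\<^sup>2 / n)"
    using n by (intro mult_right_mono) (auto simp: divide_le_eq)
  finally have z2: "z\<^sup>2 \<le> (1/3) * (a\<^sup>2 / n)" .
  have "P * w \<le> P * a + 5/3 * a\<^sup>2"
  proof -
    have "P * w \<le> P * (a + a\<^sup>2)" using w_le P by (intro mult_left_mono)
    moreover have "P * a\<^sup>2 \<le> 5/3 * a\<^sup>2" using P by (intro mult_right_mono) auto
    ultimately show ?thesis by (simp add: algebra_simps)
  qed
  then have "z \<le> (P * a + 5/3 * a\<^sup>2 - a) / n"
    using n by (simp add: z_def divide_right_mono)
  also have "\<dots> = a / n * (P - 1) + 5/3 * (a\<^sup>2 / n)" using n by (simp add: field_simps)
  finally have z3: "z \<le> a / n * (P - 1) + 5/3 * (a\<^sup>2 / n)" .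
  have "exp (- a / n) * (1 + P / n * (exp a - 1)) \<le> exp (- a / n) * exp (P / n * w)"
    unfolding w_def by (intro mult_left_mono exp_ge_add_one_self) auto
  also have "\<dots> = exp z" by (simp add: z_def flip: exp_add) (simp add: diff_divide_distrib)
  also have "\<dots> \<le> 1 + z + z\<^sup>2" using exp_le_quadratic[OF z1] .
  also have "\<dots> \<le> 1 + a / n * (P - 1) + 2 * a\<^sup>2 / n" using z2 z3 by simp
  finally show ?thesis .
qed

text \<open>
  The trade-off behind the drift bound: for a light bin \<open>u\<close> below \<open>Q\<close>, the three terms on the
  right are, up to the factor \<open>exp Q\<close>, the exponentials at \<open>Q\<close>, \<open>y\<close> and \<open>- y\<close> with \<open>y = Q - u\<close>.
\<close>

lemma linear_le_exp_pair:
  fixes u Q :: real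
  assumes Q: "Q \<ge> 1/2" and u: "u \<ge> 0"
  shows "u / (4 * Q) \<le> 1 - exp (- u) + exp (u - 2 * Q)"
proof (cases "u \<le> 2 * Q")
  case True
  define s where "s = u / (2 * Q)"
  have s: "0 \<le> s" "s \<le> 1" using True Q u by (auto simp: s_def divide_le_eq)
  \<comment> \<open>Up to \<open>2 * Q\<close> the convex function \<open>exp (- u)\<close> lies
    below its chord, which drops by at least 1/2 over this range because
    \<open>exp (- 2 * Q) \<le> 1/2\<close>.\<close>
  have "exp ((1 - s) *\<^sub>R 0 + s *\<^sub>R (- 2 * Q)) \<le> (1 - s) * exp 0 + s * exp (- 2 * Q)"
    using s by (intro convex_onD[OF exp_convex]) auto
  moreover have "s * (- 2 * Q) = - u" using Q by (simp add: s_def)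
  ultimately have 1: "exp (- u) \<le> 1 - s + s * exp (- 2 * Q)" by simp
  have "2 \<le> exp (2 * Q)" using exp_ge_add_one_self[of "2 * Q"] Q by linarith
  then have "exp (- 2 * Q) \<le> 1/2" by (simp add: exp_minus field_simps)
  then have "s * exp (- 2 * Q) \<le> s * (1/2)" using s by (intro mult_left_mono)
  then have "s / 2 \<le> 1 - exp (- u)" using 1 by simp
  moreover have "u / (4 * Q) = s / 2" by (simp add: s_def)
  ultimately show ?thesis by (smt (verit) exp_ge_zero)
next
  case False
  \<comment> \<open>Beyond \<open>2 * Q\<close> the growing exponential suffices: it starts at 1
    with slope at least 1, the left side at 1/2 with slope at most 1/2.\<close>
  have "u / (4 * Q) \<le> 1 + (u - 2 * Q)"
  proof -
    have "u / (4 * Q) = 1/2 + (u - 2 * Q) / (4 * Q)" using Q by (simp add: field_simps)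
    also have "(u - 2 * Q) / (4 * Q) \<le> (u - 2 * Q) / 1"
      using False Q by (intro divide_left_mono) auto
    finally show ?thesis by simp
  qed
  also have "\<dots> \<le> exp (u - 2 * Q)" by (rule exp_ge_add_one_self)
  also have "\<dots> \<le> 1 - exp (- u) + exp (u - 2 * Q)" using u by simp
  finally show ?thesis .
qed

section \<open>The drift of the potential\<close>

text \<open>The left side sums \<open>(P i - 1) * (exp (y i) - exp (- y i))\<close> with
  \<open>P i\<close> equal to \<open>\<delta>\<close> on \<open>H\<close> and
  \<open>1 + \<delta>\<close> on \<open>L\<close>. Moving a sixteenth of the potential to the left
  shifts the coefficients of the sums \<open>A\<close>, \<open>B\<close>, \<open>C\<close>,
  \<open>D\<close> by 1/16; then \<open>B\<close> costs at most \<open>N\<close> and the other three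
  together at most \<open>2 * N\<close>.\<close>

lemma first_order_drift_nonneg_quantile:
  fixes y :: "'a \<Rightarrow> real"
  assumes card: "real (card H) = \<delta> * N" "real (card L) = (1 - \<delta>) * N"
    and N: "N > 0" and d: "1/3 \<le> \<delta>" "\<delta> \<le> 2/3"
    and bal: "sum y H + sum y L = 0"
    and Q: "Q \<ge> 0" and yH: "\<And>i. i \<in> H \<Longrightarrow> Q \<le> y i" and yL: "\<And>i. i \<in> L \<Longrightarrow> y i \<le> Q"
  shows "\<delta> * (\<Sum>i\<in>L. exp (y i) - exp (- y i)) - (1 - \<delta>) * (\<Sum>i\<in>H. exp (y i) - exp (- y i))
    \<le> 3 * N - ((\<Sum>i\<in>H. exp (y i) + exp (- y i)) + (\<Sum>i\<in>L. exp (y i) + exp (- y i))) / 16"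
proof -
  define A where "A = (\<Sum>i\<in>H. exp (y i))"
  define B where "B = (\<Sum>i\<in>H. exp (- y i))"
  define C where "C = (\<Sum>i\<in>L. exp (y i))"
  define D where "D = (\<Sum>i\<in>L. exp (- y i))"
  define E where "E = N * exp Q"
  have E: "E \<ge> 0" using N by (simp add: E_def)
  have A: "\<delta> * E \<le> A"
    using sum_mono[of H "\<lambda>_. exp Q" "\<lambda>i. exp (y i)"] yH card by (simp add: A_def E_def)
  have "B \<le> (\<Sum>i\<in>H. 1)" unfolding B_def using yH Q by (intro sum_mono) force
  then have B: "B \<le> \<delta> * N" using card by simp
  have B0: "B \<ge> 0" by (auto simp: B_def intro: sum_nonneg)
  have A0: "A \<ge> 0" by (auto simp: A_def intro: sum_nonneg)
  have C: "C \<le> (1 - \<delta>) * E"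
    using sum_mono[of L "\<lambda>i. exp (y i)" "\<lambda>_. exp Q"] yL card by (simp add: C_def E_def)
  have C0: "C \<ge> 0" by (auto simp: C_def intro: sum_nonneg)
  have D0: "D \<ge> 0" by (auto simp: D_def intro: sum_nonneg)
  have Bt: "(17/16 - \<delta>) * B \<le> N"
  proof -
    have "(17/16 - \<delta>) * B \<le> 1 * (\<delta> * N)" using B B0 d N by (intro mult_mono) auto
    then show ?thesis using d N by (simp add: mult_left_le_one_le order_trans)
  qed
  have main: "(\<delta> + 1/16) * C - (\<delta> - 1/16) * D - (15/16 - \<delta>) * A \<le> 2 * N"
  proof (cases "Q \<ge> 1/2")
    case False
    have "exp Q \<le> exp (1/2)" using False by simp
    also have "\<dots> \<le> 2" using exp_bound[of "1/2::real"] by (simp add: power2_eq_square)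
    finally have "E \<le> 2 * N" using N by (simp add: E_def)
    moreover have "(\<delta> + 1/16) * C \<le> E"
    proof -
      have "(\<delta> + 1/16) * C \<le> 1 * ((1 - \<delta>) * E)" using C C0 d E by (intro mult_mono) auto
      then show ?thesis using d E by (simp add: mult_left_le_one_le order_trans)
    qed
    moreover have "(\<delta> - 1/16) * D \<ge> 0" "(15/16 - \<delta>) * A \<ge> 0" using d D0 A0 by auto
    ultimately show ?thesis by linarith
  next
    case True
    \<comment> \<open>The loads sum to zero, so the light bins lie below \<open>Q\<close> by at least \<open>N * Q\<close> in total.\<close>
    have "(\<Sum>i\<in>L. Q - y i) = (1 - \<delta>) * N * Q + sum y H"
      using card bal by (simp add: sum_subtractf)
    moreover have "\<delta> * N * Q \<le> sum y H"
      using sum_mono[of H "\<lambda>_. Q" y] yH card by simp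
    ultimately have "N * Q \<le> (\<Sum>i\<in>L. Q - y i)" by (simp add: algebra_simps)
    then have "N / 4 \<le> (\<Sum>i\<in>L. Q - y i) / (4 * Q)" using True by (simp add: field_simps)
    also have "\<dots> = (\<Sum>i\<in>L. (Q - y i) / (4 * Q))" by (simp add: sum_divide_distrib)
    also have "\<dots> \<le> (\<Sum>i\<in>L. 1 - exp (- (Q - y i)) + exp ((Q - y i) - 2 * Q))"
      using True yL by (intro sum_mono linear_le_exp_pair) auto
    finally have "N / 4 * exp Q \<le> (\<Sum>i\<in>L. 1 - exp (- (Q - y i)) + exp ((Q - y i) - 2 * Q)) * exp Q"
      by (intro mult_right_mono) auto
    also have "\<dots> = (\<Sum>i\<in>L. exp Q - exp (y i) + exp (- y i))"
      unfolding sum_distrib_right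
      by (intro sum.cong) (simp_all add: algebra_simps flip: exp_add)
    also have "\<dots> = (1 - \<delta>) * E - C + D"
      using card by (simp add: C_def D_def E_def sum.distrib sum_subtractf)
    finally have key: "C - D \<le> (1 - \<delta>) * E - E / 4" by (simp add: E_def)
    \<comment> \<open>\<open>key\<close> needs equal weights on \<open>C\<close> and
      \<open>D\<close>; the surplus \<open>C / 8\<close> is bounded through
      \<open>C \<le> (1 - \<delta>) * E\<close>. The multiples of \<open>E\<close> then cancel up to
      1/16, which the gain \<open>(\<delta> - 1/16) / 4\<close> outweighs once
      \<open>\<delta> \<ge> 5/16\<close>.\<close>
    have "(\<delta> - 1/16) * (C - D) \<le> (\<delta> - 1/16) * ((1 - \<delta>) * E - E / 4)"
      using key d by (intro mult_left_mono) auto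
    moreover have "(15/16 - \<delta>) * (\<delta> * E) \<le> (15/16 - \<delta>) * A"
      using A d by (intro mult_left_mono) auto
    moreover have "(\<delta> - 1/16) * ((1 - \<delta>) * E - E / 4) + (1 - \<delta>) * E / 8 - (15/16 - \<delta>) * (\<delta> * E)
        = (1/16 - (\<delta> - 1/16) / 4) * E" by (simp add: field_simps)
    moreover have "(1/16 - (\<delta> - 1/16) / 4) * E \<le> 0"
      using d E by (intro mult_nonpos_nonneg) auto
    moreover have "(\<delta> + 1/16) * C - (\<delta> - 1/16) * D = (\<delta> - 1/16) * (C - D) + C / 8"
      by (simp add: field_simps)
    ultimately show ?thesis using C N by linarith
  qed
  have "\<delta> * (C - D) - (1 - \<delta>) * (A - B) + (A + B + (C + D)) / 16
    = ((\<delta> + 1/16) * C - (\<delta> - 1/16) * D - (15/16 - \<delta>) * A) + (17/16 - \<delta>) * B"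
    by (simp add: field_simps)
  then have "\<delta> * (C - D) - (1 - \<delta>) * (A - B) \<le> 3 * N - (A + B + (C + D)) / 16"
    using main Bt by linarith
  then show ?thesis by (simp add: A_def B_def C_def D_def sum.distrib sum_subtractf)
qed

lemma first_order_drift:
  fixes y :: "'a \<Rightarrow> real"
  assumes card: "real (card H) = \<delta> * N" "real (card L) = (1 - \<delta>) * N"
    and N: "N > 0" and d: "1/3 \<le> \<delta>" "\<delta> \<le> 2/3"
    and bal: "sum y H + sum y L = 0"
    and yH: "\<And>i. i \<in> H \<Longrightarrow> Q \<le> y i" and yL: "\<And>i. i \<in> L \<Longrightarrow> y i \<le> Q"
  shows "\<delta> * (\<Sum>i\<in>L. exp (y i) - exp (- y i)) - (1 - \<delta>) * (\<Sum>i\<in>H. exp (y i) - exp (- y i))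
    \<le> 3 * N - ((\<Sum>i\<in>H. exp (y i) + exp (- y i)) + (\<Sum>i\<in>L. exp (y i) + exp (- y i))) / 16"
proof (cases "Q \<ge> 0")
  case True
  then show ?thesis using assms by (intro first_order_drift_nonneg_quantile[where Q = Q]) auto
next
  case False
  \<comment> \<open>The claim is invariant under negating \<open>y\<close>, swapping \<open>H\<close> and \<open>L\<close>, and replacing \<open>\<delta>\<close> by \<open>1 - \<delta>\<close>.\<close>
  have "(1 - \<delta>) * (\<Sum>i\<in>H. exp (- y i) - exp (- (- y i))) - (1 - (1 - \<delta>)) * (\<Sum>i\<in>L. exp (- y i) - exp (- (- y i)))
    \<le> 3 * N - ((\<Sum>i\<in>L. exp (- y i) + exp (- (- y i))) + (\<Sum>i\<in>H. exp (- y i) + exp (- (- y i)))) / 16"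
    using assms False
    by (intro first_order_drift_nonneg_quantile[where Q = "- Q"]) (auto simp: sum_negf)
  then show ?thesis by (simp add: sum.distrib sum_subtractf algebra_simps)
qed

section \<open>One step of the process\<close>

definition centered_load :: "nat \<Rightarrow> nat list \<Rightarrow> nat \<Rightarrow> real" where
  "centered_load n h i = real (load h i) - real (length h) / real n"

definition potential :: "real \<Rightarrow> nat \<Rightarrow> nat list \<Rightarrow> real" where
  "potential a n h =
     (\<Sum>i\<in>{1..n}. exp (a * centered_load n h i) + exp (- (a * centered_load n h i)))"

lemma potential_nonneg: "0 \<le> potential a n h"
  unfolding potential_def by (intro sum_nonneg) (simp add: add_nonneg_nonneg)

lemma exp_gap_le_potential:
  assumes "n \<ge> 1"
  shows "exp (a * gap n h) \<le> potential a n h"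
proof -
  have "Max (load h ` {1..n}) \<in> load h ` {1..n}" using assms by (intro Max_in) auto
  then obtain i where i: "i \<in> {1..n}" "Max (load h ` {1..n}) = load h i" by auto
  have "exp (a * gap n h) \<le> exp (a * centered_load n h i) + exp (- (a * centered_load n h i))"
    using i by (simp add: gap_def centered_load_def)
  also have "\<dots> \<le> potential a n h"
    unfolding potential_def using i(1)
    by (intro member_le_sum) (auto simp: add_nonneg_nonneg)
  finally show ?thesis .
qed

lemma sum_centered_load:
  assumes "set h \<subseteq> {1..n}" "n \<ge> 1"
  shows "(\<Sum>i\<in>{1..n}. centered_load n h i) = 0"
proof -
  have "(\<Sum>i\<in>{1..n}. load h i) = length h"
    unfolding load_def using assms(1)
    by (intro sum_count_set) auto
  then have "(\<Sum>i\<in>{1..n}. real (load h i)) = real (length h)"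
    by (metis of_nat_sum)
  then show ?thesis using assms(2) by (simp add: centered_load_def sum_subtractf)
qed

lemma centered_load_Cons:
  "centered_load n (b # h) i = centered_load n h i - 1 / real n + (if i = b then 1 else 0)"
  by (auto simp: centered_load_def load_def add_divide_distrib)


text \<open>Each pair of samples splits \<open>f\<close> between its two bins, and both samples
  contribute equally by symmetry. Summing the share of bin \<open>i\<close> over its partners, a
  fraction \<open>\<delta>\<close> of which is heavy by \<open>H\<close>, gives the weights.\<close>

lemma expectation_quantile_choice:
  fixes f :: "nat \<Rightarrow> real"
  assumes n: "n \<ge> 1" and H: "real (card {i \<in> {1..n}. real (r i) \<le> \<delta> * real n}) = \<delta> * real n"
  shows "measure_pmf.expectation (quantile_choice n \<delta> r) f =
    (\<Sum>i\<in>{1..n}. (if real (r i) \<le> \<delta> * real n then \<delta> else 1 + \<delta>) / real n * f i)"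
proof -
  \<comment> \<open>\<open>w i j\<close> is the probability that the first sample \<open>i\<close>
    wins against \<open>j\<close>; on the diagonal the two shares of 1/2 add up to the point
    mass.\<close>
  define w :: "nat \<Rightarrow> nat \<Rightarrow> real" where
    "w i j = (if real (r i) \<le> \<delta> * real n then if real (r j) \<le> \<delta> * real n then 1/2 else 0
      else if real (r j) \<le> \<delta> * real n then 1 else 1/2)" for i j
  define g where "g = (\<lambda>i j. if real (r i) > \<delta> * real n \<and> \<not> real (r j) > \<delta> * real n then return_pmf i
        else if real (r j) > \<delta> * real n \<and> \<not> real (r i) > \<delta> * real n then return_pmf j
        else pmf_of_set {i, j})"
  have g: "measure_pmf.expectation (g i j) f = w i j * f i + w j i * f j" for i j
    by (cases "i = j") (auto simp: g_def w_def integral_pmf_of_set field_simps)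
  have fin: "finite (set_pmf (g i j))" for i j by (auto simp: g_def)
  have w_sum: "(\<Sum>j\<in>{1..n}. w i j) = (if real (r i) \<le> \<delta> * real n then \<delta> else 1 + \<delta>) * real n / 2" for i
  proof -
    \<comment> \<open>The share separates: 1/2 for being light plus 1/2 for meeting a heavy
      partner.\<close>
    have "w i j = (if real (r i) \<le> \<delta> * real n then 0 else 1/2)
        + (if real (r j) \<le> \<delta> * real n then 1/2 else 0)" for j
      by (simp add: w_def)
    then have "(\<Sum>j\<in>{1..n}. w i j) = (if real (r i) \<le> \<delta> * real n then 0 else 1/2) * real n
        + (\<Sum>j\<in>{1..n}. if real (r j) \<le> \<delta> * real n then 1/2 else 0)"
      by (simp add: sum.distrib)
    also have "(\<Sum>j\<in>{1..n}. if real (r j) \<le> \<delta> * real n then 1/2 else (0::real))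
        = (\<Sum>j\<in>{j \<in> {1..n}. real (r j) \<le> \<delta> * real n}. 1/2)"
      by (intro sum.inter_filter[symmetric]) auto
    also have "\<dots> = \<delta> * real n / 2" using H by simp
    finally show ?thesis by (simp add: algebra_simps)
  qed
  have "quantile_choice n \<delta> r = pmf_of_set {1..n} \<bind> (\<lambda>i. pmf_of_set {1..n} \<bind> (\<lambda>j. g i j))"
    by (simp add: quantile_choice_def g_def)
  then have "measure_pmf.expectation (quantile_choice n \<delta> r) f =
      (\<Sum>i\<in>{1..n}. (\<Sum>j\<in>{1..n}. w i j * f i + w j i * f j) / real n) / real n"
    using n by (simp add: pmf_expectation_bind_pmf_of_set fin g divide_inverse_commute sum_distrib_left)
  also have "\<dots> = ((\<Sum>i\<in>{1..n}. \<Sum>j\<in>{1..n}. w i j * f i)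
      + (\<Sum>i\<in>{1..n}. \<Sum>j\<in>{1..n}. w j i * f j)) / (real n)\<^sup>2"
    by (simp add: sum.distrib power2_eq_square flip: sum_divide_distrib)
  also have "(\<Sum>i\<in>{1..n}. \<Sum>j\<in>{1..n}. w j i * f j) = (\<Sum>i\<in>{1..n}. \<Sum>j\<in>{1..n}. w i j * f i)"
    by (rule sum.swap)
  also have "(\<Sum>i\<in>{1..n}. \<Sum>j\<in>{1..n}. w i j * f i)
      = (\<Sum>i\<in>{1..n}. (if real (r i) \<le> \<delta> * real n then \<delta> else 1 + \<delta>) * real n / 2 * f i)"
    unfolding sum_distrib_right[symmetric] w_sum ..
  finally have "measure_pmf.expectation (quantile_choice n \<delta> r) f =
      (\<Sum>i\<in>{1..n}. 2 * ((if real (r i) \<le> \<delta> * real n then \<delta> else 1 + \<delta>) * real n / 2 * f i)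
        / (real n)\<^sup>2)"
    unfolding mult_2[symmetric] sum_distrib_left sum_divide_distrib .
  also have "\<dots> = (\<Sum>i\<in>{1..n}. (if real (r i) \<le> \<delta> * real n then \<delta> else 1 + \<delta>) / real n * f i)"
    using n by (intro sum.cong) (simp_all add: field_simps power2_eq_square)
  finally show ?thesis .
qed

lemma set_pmf_quantile_choice:
  assumes "n \<ge> 1"
  shows "set_pmf (quantile_choice n \<delta> r) \<subseteq> {1..n}"
  using assms by (auto simp: quantile_choice_def set_pmf_of_set split: if_splits)

text \<open>Per unit of potential and up to the factor \<open>1 / n\<close>, the first-order drift
  gains \<open>a / 16\<close> and the second-order error costs \<open>2 * a\<^sup>2\<close>, so the
  potential contracts for \<open>a < 1/32\<close> up to an additive constant.\<close>

lemma expectation_potential_step: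
  assumes n: "n \<ge> 60" and d: "\<delta> \<in> {1/3..2/3}" "\<delta> = real k / real n"
    and h: "set h \<subseteq> {1..n}" and r: "is_ranking n h r" and a: "0 < a" "a \<le> 1"
  shows "measure_pmf.expectation (quantile_choice n \<delta> r) (\<lambda>b. potential a n (b # h))
    \<le> (1 - a * (1/16 - 2 * a) / real n) * potential a n h + 3 * a"
proof -
  define N where "N = real n"
  have N: "N \<ge> 60" using n by (simp add: N_def)
  have dN: "\<delta> * N = real k" using d N by (simp add: N_def)
  have "real k \<le> 2/3 * N" using d(1) N by (simp add: mult_right_mono flip: dN)
  then have kn: "k \<le> n" unfolding N_def by linarith
  have "real k \<ge> 1/3 * N" using d(1) N by (simp add: mult_right_mono flip: dN)
  then have k1: "k \<ge> 1" using N by linarith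
  have bij: "bij_betw r {1..n} {1..n}" using r by (simp add: is_ranking_def)
  have mono: "load h i \<ge> load h j" if "i \<in> {1..n}" "j \<in> {1..n}" "r i \<le> r j" for i j
    using r that bij_betw_imp_inj_on[OF bij] unfolding is_ranking_def
    by (metis inj_onD le_neq_implies_less order_refl)
  define H where "H = {i \<in> {1..n}. r i \<le> k}"
  define L where "L = {i \<in> {1..n}. \<not> r i \<le> k}"
  define P where "P i = (if r i \<le> k then \<delta> else 1 + \<delta>)" for i
  define y where "y i = a * centered_load n h i" for i
  have thr: "real (r i) \<le> \<delta> * real n \<longleftrightarrow> r i \<le> k" for i
    using dN by (simp add: N_def)
  have HL: "H \<union> L = {1..n}" "H \<inter> L = {}" "finite H" "finite L" by (auto simp: H_def L_def)
  have "r ` H = {1..k}"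
  proof (intro equalityI subsetI)
    fix x assume "x \<in> {1..k}"
    then have "x \<in> r ` {1..n}" using bij kn by (auto simp: bij_betw_def)
    then show "x \<in> r ` H" using \<open>x \<in> {1..k}\<close> by (auto simp: H_def)
  qed (use bij in \<open>auto simp: H_def bij_betw_def\<close>)
  moreover have "inj_on r H"
    using bij_betw_imp_inj_on[OF bij] by (rule inj_on_subset) (auto simp: H_def)
  ultimately have cH: "card H = k" using card_image[of r H] by simp
  have "card H + card L = n" using card_Un_disjoint[OF HL(3,4,2)] HL(1) by simp
  then have cL: "real (card L) = (1 - \<delta>) * N"
    using cH dN by (simp add: N_def algebra_simps)
  have sum_split: "(\<Sum>i\<in>{1..n}. f i) = (\<Sum>i\<in>H. f i) + (\<Sum>i\<in>L. f i)" for f :: "nat \<Rightarrow> real"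
    using sum.union_disjoint[OF HL(3,4,2), of f] HL(1) by simp
  \<comment> \<open>The bin of rank \<open>k\<close> is the last heavy one; its value
    \<open>y i0\<close> serves as the separating level \<open>Q\<close>.\<close>
  have "k \<in> r ` {1..n}" using bij k1 kn by (simp add: bij_betw_def)
  then obtain i0 where i0: "i0 \<in> {1..n}" "r i0 = k" by auto
  have y_mono: "y j \<le> y i" if "load h j \<le> load h i" for i j
    using that a by (simp add: y_def centered_load_def)
  have drift: "\<delta> * (\<Sum>i\<in>L. exp (y i) - exp (- y i)) - (1 - \<delta>) * (\<Sum>i\<in>H. exp (y i) - exp (- y i))
    \<le> 3 * N - ((\<Sum>i\<in>H. exp (y i) + exp (- y i)) + (\<Sum>i\<in>L. exp (y i) + exp (- y i))) / 16"
  proof (rule first_order_drift)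
    show "real (card H) = \<delta> * N" using cH dN by simp
    show "sum y H + sum y L = 0"
      using sum_split[of y] sum_centered_load[OF h] n by (simp add: y_def flip: sum_distrib_left)
    show "y i0 \<le> y i" if "i \<in> H" for i using that i0 by (intro y_mono mono) (auto simp: H_def)
    show "y i \<le> y i0" if "i \<in> L" for i using that i0 by (intro y_mono mono) (auto simp: L_def)
  qed (use cL N d(1) in auto)
  have pot: "potential a n h = (\<Sum>i\<in>H. exp (y i) + exp (- y i)) + (\<Sum>i\<in>L. exp (y i) + exp (- y i))"
    unfolding potential_def y_def by (rule sum_split)
  have P_sum: "(\<Sum>i\<in>{1..n}. P i) = N"
  proof -
    have "(\<Sum>i\<in>H. P i) = \<delta> * real k" using cH by (simp add: P_def H_def)
    moreover have "(\<Sum>i\<in>L. P i) = (1 + \<delta>) * ((1 - \<delta>) * N)" using cL by (simp add: P_def L_def)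
    ultimately show ?thesis unfolding sum_split dN[symmetric] by (simp add: algebra_simps)
  qed
  \<comment> \<open>A general exponent \<open>s\<close> serves both \<open>a\<close> and
    \<open>- a\<close>. As the weights \<open>P b / N\<close> sum to 1, only the ball landing in
    \<open>i\<close> leaves a correction.\<close>
  have step: "(\<Sum>b\<in>{1..n}. P b / N * exp (s * centered_load n (b # h) i))
      = exp (s * centered_load n h i) * (exp (- s / N) * (1 + P i / N * (exp s - 1)))"
    if i: "i \<in> {1..n}" for s i
  proof -
    have "P b / N * exp (s * centered_load n (b # h) i)
      = exp (s * centered_load n h i) * exp (- s / N) * (P b / N + (if i = b then P i / N * (exp s - 1) else 0))" for b
    proof -
      have "exp (s * centered_load n (b # h) i)
        = exp (s * centered_load n h i) * exp (- s / N) * (if i = b then exp s else 1)"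
        by (simp add: centered_load_Cons N_def distrib_left right_diff_distrib flip: exp_add)
      then show ?thesis using N by (auto simp: field_simps)
    qed
    then have "(\<Sum>b\<in>{1..n}. P b / N * exp (s * centered_load n (b # h) i))
      = exp (s * centered_load n h i) * exp (- s / N)
          * (\<Sum>b\<in>{1..n}. P b / N + (if i = b then P i / N * (exp s - 1) else 0))"
      by (simp add: sum_distrib_left)
    also have "(\<Sum>b\<in>{1..n}. P b / N + (if i = b then P i / N * (exp s - 1) else 0))
      = 1 + P i / N * (exp s - 1)"
      using i P_sum N by (simp add: sum.distrib flip: sum_divide_distrib)
    finally show ?thesis by (simp only: mult.assoc)
  qed
  have P_bounds: "0 \<le> P i" "P i \<le> 5/3" for i using d(1) by (auto simp: P_def)
  have "measure_pmf.expectation (quantile_choice n \<delta> r) (\<lambda>b. potential a n (b # h))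
      = (\<Sum>b\<in>{1..n}. P b / N * potential a n (b # h))"
    using n cH dN thr by (subst expectation_quantile_choice) (auto simp: H_def P_def N_def)
  also have "\<dots> = (\<Sum>i\<in>{1..n}. (\<Sum>b\<in>{1..n}. P b / N * exp (a * centered_load n (b # h) i))
      + (\<Sum>b\<in>{1..n}. P b / N * exp (- a * centered_load n (b # h) i)))"
    unfolding potential_def sum_distrib_left
    by (subst sum.swap) (simp add: distrib_left sum.distrib)
  also have "\<dots> = (\<Sum>i\<in>{1..n}. exp (y i) * (exp (- a / N) * (1 + P i / N * (exp a - 1)))
      + exp (- y i) * (exp (- (- a) / N) * (1 + P i / N * (exp (- a) - 1))))"
    by (intro sum.cong refl arg_cong2[where f = "(+)"]) (simp_all only: step y_def flip: mult_minus_left)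
  also have "\<dots> \<le> (\<Sum>i\<in>{1..n}. exp (y i) * (1 + a / N * (P i - 1) + 2 * a\<^sup>2 / N)
      + exp (- y i) * (1 + (- a) / N * (P i - 1) + 2 * (- a)\<^sup>2 / N))"
    using a P_bounds N
    by (intro sum_mono add_mono mult_left_mono centered_growth_factor_le) auto
  also have "\<dots> = (1 + 2 * a\<^sup>2 / N) * (\<Sum>i\<in>{1..n}. exp (y i) + exp (- y i))
      + a / N * (\<Sum>i\<in>{1..n}. (P i - 1) * (exp (y i) - exp (- y i)))"
    unfolding sum_distrib_left sum.distrib[symmetric]
    using N by (intro sum.cong) (simp_all add: field_simps)
  also have "(\<Sum>i\<in>{1..n}. exp (y i) + exp (- y i)) = potential a n h"
    by (simp add: potential_def y_def)
  also have "(\<Sum>i\<in>{1..n}. (P i - 1) * (exp (y i) - exp (- y i)))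
      = \<delta> * (\<Sum>i\<in>L. exp (y i) - exp (- y i)) - (1 - \<delta>) * (\<Sum>i\<in>H. exp (y i) - exp (- y i))"
  proof -
    have "(\<Sum>i\<in>H. (P i - 1) * (exp (y i) - exp (- y i))) = (\<Sum>i\<in>H. - (1 - \<delta>) * (exp (y i) - exp (- y i)))"
      by (intro sum.cong) (auto simp: H_def P_def)
    moreover have "(\<Sum>i\<in>L. (P i - 1) * (exp (y i) - exp (- y i))) = (\<Sum>i\<in>L. \<delta> * (exp (y i) - exp (- y i)))"
      by (intro sum.cong) (auto simp: L_def P_def)
    ultimately show ?thesis unfolding sum_split by (simp only: flip: sum_distrib_left)
  qed
  also have "a / N * \<dots> \<le> a / N * (3 * N - potential a n h / 16)"
    using drift a N unfolding pot by (intro mult_left_mono) auto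
  also have "(1 + 2 * a\<^sup>2 / N) * potential a n h + a / N * (3 * N - potential a n h / 16)
      = (1 - a * (1/16 - 2 * a) / real n) * potential a n h + 3 * a"
    using N by (simp add: N_def field_simps power2_eq_square)
  finally show ?thesis by simp
qed

section \<open>The potential stays linear in the number of bins\<close>

lemma set_pmf_quantile_process:
  assumes "n \<ge> 1" "h \<in> set_pmf (quantile_process n \<delta> R t)"
  shows "set h \<subseteq> {1..n}"
  using assms(2)
proof (induction t arbitrary: h)
  case (Suc t)
  then show ?case using set_pmf_quantile_choice[OF assms(1)] by fastforce
qed simp

text \<open>The one-step bound iterates an affine contraction with fixed point
  \<open>400/3 * n\<close>, so the level \<open>134 * n\<close> is preserved, and the initial value
  \<open>2 * n\<close> lies below it.\<close>

lemma nn_integral_potential_le: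
  assumes n: "n \<ge> 60" and d: "\<delta> \<in> {1/3..2/3}" "\<delta> = real k / real n"
    and R: "valid_ranking_rule n R"
  shows "(\<integral>\<^sup>+h. ennreal (potential (1/50) n h) \<partial>quantile_process n \<delta> R t) \<le> ennreal (134 * real n)"
proof (induction t)
  case 0
  then show ?case by (simp add: potential_def centered_load_def load_def)
next
  case (Suc t)
  \<comment> \<open>This is \<open>1 - a * (1/16 - 2 * a) / n\<close> at
    \<open>a = 1/50\<close>.\<close>
  define c where "c = 1 - 9 / (20000 * real n)"
  have c: "c \<ge> 0" using n by (simp add: c_def)
  \<comment> \<open>The bound is uniform in the ranking \<open>r\<close>, so it survives averaging
    over a randomised, history-dependent tie-breaking rule.\<close>
  have step: "(\<integral>\<^sup>+b. ennreal (potential (1/50) n (b # h)) \<partial>quantile_choice n \<delta> r)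
      \<le> ennreal c * ennreal (potential (1/50) n h) + ennreal (3/50)"
    if "h \<in> set_pmf (quantile_process n \<delta> R t)" "r \<in> set_pmf (R h)" for h r
  proof -
    have h: "set h \<subseteq> {1..n}" using n by (intro set_pmf_quantile_process[OF _ that(1)]) simp
    have r: "is_ranking n h r" using R h that by (auto simp: valid_ranking_rule_def)
    have "finite (set_pmf (quantile_choice n \<delta> r))"
      using n by (intro finite_subset[OF set_pmf_quantile_choice]) auto
    then have "(\<integral>\<^sup>+b. ennreal (potential (1/50) n (b # h)) \<partial>quantile_choice n \<delta> r)
        = ennreal (measure_pmf.expectation (quantile_choice n \<delta> r) (\<lambda>b. potential (1/50) n (b # h)))"
      by (intro nn_integral_eq_integral integrable_measure_pmf_finite) (auto simp: potential_nonneg)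
    also have "\<dots> \<le> ennreal (c * potential (1/50) n h + 3/50)"
      using expectation_potential_step[OF n d h r, of "1/50"] by (intro ennreal_leI) (simp add: c_def)
    also have "\<dots> = ennreal c * ennreal (potential (1/50) n h) + ennreal (3/50)"
      using c potential_nonneg[of "1/50" n h] by (simp only: ennreal_plus ennreal_mult mult_nonneg_nonneg)
    finally show ?thesis .
  qed
  have "(\<integral>\<^sup>+h. ennreal (potential (1/50) n h) \<partial>quantile_process n \<delta> R (Suc t))
    = (\<integral>\<^sup>+h. \<integral>\<^sup>+r. \<integral>\<^sup>+b. ennreal (potential (1/50) n (b # h)) \<partial>quantile_choice n \<delta> r \<partial>R h
        \<partial>quantile_process n \<delta> R t)"
    by simp
  also have "\<dots> \<le> (\<integral>\<^sup>+h. \<integral>\<^sup>+r. ennreal c * ennreal (potential (1/50) n h) + ennreal (3/50) \<partial>R h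
        \<partial>quantile_process n \<delta> R t)"
    by (intro nn_integral_mono_AE AE_pmfI step)
  also have "\<dots> = ennreal c * (\<integral>\<^sup>+h. ennreal (potential (1/50) n h) \<partial>quantile_process n \<delta> R t) + ennreal (3/50)"
    by (simp add: nn_integral_add nn_integral_cmult)
  also have "\<dots> \<le> ennreal c * ennreal (134 * real n) + ennreal (3/50)"
    using Suc by (intro add_mono mult_left_mono) auto
  also have "\<dots> = ennreal (c * (134 * real n) + 3/50)"
    using c by (subst ennreal_plus) (auto simp: ennreal_mult)
  also have "\<dots> \<le> ennreal (134 * real n)"
    using n by (intro ennreal_leI) (simp add: c_def field_simps)
  finally show ?case .
qed

section \<open>Tail bound for the gap from the expected potential\<close>

lemma prob_gap_le:
  assumes n: "n \<ge> 60" and d: "\<delta> \<in> {1/3..2/3}" "\<delta> = real k / real n"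
    and R: "valid_ranking_rule n R"
  shows "measure_pmf.prob (quantile_process n \<delta> R m) {h. gap n h \<le> 300 * ln (real n)}
    \<ge> 1 - 134 / real n ^ 2"
proof -
  let ?M = "measure_pmf (quantile_process n \<delta> R m)"
  let ?X = "{h. gap n h > 300 * ln (real n)}"
  \<comment> \<open>The exponent is \<open>300 * (1/50) = 6\<close>.\<close>
  have "real n ^ 6 = exp (ln (real n ^ 6))" using n by simp
  also have "\<dots> = exp (6 * ln (real n))" using n by (simp add: ln_realpow)
  finally have n6: "exp (6 * ln (real n)) = real n ^ 6" by simp
  have "1 \<le> ennreal (1 / real n ^ 6) * ennreal (potential (1/50) n h)" if "h \<in> ?X" for h
  proof -
    have "real n ^ 6 \<le> exp (1/50 * gap n h)" using that by (simp flip: n6)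
    also have "\<dots> \<le> potential (1/50) n h" using n by (intro exp_gap_le_potential) auto
    finally have "1 \<le> 1 / real n ^ 6 * potential (1/50) n h" using n by (simp add: field_simps)
    then have "ennreal 1 \<le> ennreal (1 / real n ^ 6 * potential (1/50) n h)" by (rule ennreal_leI)
    then show ?thesis using potential_nonneg[of "1/50" n h] by (subst ennreal_mult[symmetric]) auto
  qed
  then have "emeasure ?M ?X \<le> emeasure ?M {h \<in> UNIV. 1 \<le> ennreal (1 / real n ^ 6) * ennreal (potential (1/50) n h)}"
    by (intro emeasure_mono) auto
  also have "\<dots> \<le> ennreal (1 / real n ^ 6) * (\<integral>\<^sup>+h. ennreal (potential (1/50) n h) * indicator UNIV h \<partial>?M)"
    by (intro nn_integral_Markov_inequality) auto
  also have "\<dots> \<le> ennreal (1 / real n ^ 6) * ennreal (134 * real n)"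
    using nn_integral_potential_le[OF assms] by (intro mult_left_mono) auto
  also have "\<dots> = ennreal (134 / real n ^ 5)"
  proof -
    have "1 / real n ^ 6 * (134 * real n) = 134 / real n ^ 5"
      using n by (simp add: power_Suc[of _ 5, simplified])
    then show ?thesis using n by (subst ennreal_mult[symmetric]) auto
  qed
  \<comment> \<open>Markov gives order \<open>n ^ 5\<close> in the denominator, which is weakened to
    the claimed rate.\<close>
  also have "\<dots> \<le> ennreal (134 / real n ^ 2)"
    using n by (intro ennreal_leI divide_left_mono power_increasing) auto
  finally have "measure ?M ?X \<le> 134 / real n ^ 2"
    by (simp add: measure_pmf.emeasure_eq_measure)
  moreover have "{h. gap n h \<le> 300 * ln (real n)} = UNIV - ?X" by auto
  then have "measure ?M {h. gap n h \<le> 300 * ln (real n)} = 1 - measure ?M ?X"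
    using measure_pmf.prob_compl[of ?X "quantile_process n \<delta> R m"] by simp
  ultimately show ?thesis by simp
qed

theorem theorem5p2:
  "\<exists>err :: nat \<Rightarrow> real. err \<in> O(\<lambda>n. 1 / real n ^ 2) \<and>
     (\<forall>\<^sub>F n in sequentially.
        \<forall>(\<delta>::real) (R::ranking_rule) (m::nat).
          \<delta> \<in> {1/3..2/3} \<longrightarrow> (\<exists>k::nat. \<delta> = real k / real n) \<longrightarrow>
          valid_ranking_rule n R \<longrightarrow> m \<ge> 1 \<longrightarrow>
          measure_pmf.prob (quantile_process n \<delta> R m) {h. gap n h \<le> 300 * ln (real n)}
            \<ge> 1 - err n)"
proof (intro exI conjI)
  \<comment> \<open>The bound of \<open>prob_gap_le\<close> and its threshold 60 do not depend on
    \<open>\<delta>\<close>, \<open>R\<close> or \<open>m\<close>, so a single error function works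
    for all of them.\<close>
  show "(\<lambda>n. 134 / real n ^ 2) \<in> O(\<lambda>n. 1 / real n ^ 2)"
    by (rule bigoI[where c = 134]) simp
  show "\<forall>\<^sub>F n in sequentially.
        \<forall>(\<delta>::real) (R::ranking_rule) (m::nat).
          \<delta> \<in> {1/3..2/3} \<longrightarrow> (\<exists>k::nat. \<delta> = real k / real n) \<longrightarrow>
          valid_ranking_rule n R \<longrightarrow> m \<ge> 1 \<longrightarrow>
          measure_pmf.prob (quantile_process n \<delta> R m) {h. gap n h \<le> 300 * ln (real n)}
            \<ge> 1 - 134 / real n ^ 2"
    using eventually_ge_at_top[of 60] by eventually_elim (use prob_gap_le in blast)
qed

end
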